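(* Let $m\ge 1$. For non-preemptive makespan minimization on $m$ identical machines with testing, no deterministic online algorithm is $c$-competitive for any $c<2-\frac{1}{m}$. This holds even when restricted to instances in which all testing times equal $1$.
   Context: Scheduling with testing on $m$ identical parallel machines: there are $n$ jobs; each job $j$ has a testing time $t_j\ge 0$, an upper bound $u_j\ge 0$ and a processing time $p_j$ with $0\le p_j\le u_j$. A job can either be run untested, occupying a machine for time $u_j$, or be tested and then executed, occupying a machine for total time $t_j+p_j$; the value $p_j$ is revealed to the algorithm only when the test of $j$ is completed. Initially the algorithm knows $m$, $n$ and all $t_j,u_j$ (and may order the jobs using them), but not the $p_j$. In the non-preemptive setting each job is assigned to a single machine and run there without interruption (test followed directly by execution if tested). The objective is the makespan (maximum machine load). $\mathrm{OPT}$ denotes the minimum makespan achievable by an offline scheduler knowing all $p_j$ (so job $j$ needs time $\rho_j=\min(t_j+p_j,u_j)$ in the optimum). A deterministic algorithm is $c$-competitive if its makespan $\mathrm{ALG}$ satisfies $\mathrm{ALG}\le c\cdot\mathrm{OPT}$ on every instance. *)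

theory Defs
  imports Complex_Main
begin

record job =
  test_time :: real
  upper_bound :: real
  proc_time :: real

type_synonym inst = "job list"

definition valid_instances :: "inst set" where
  "valid_instances =
     {I. \<forall>x\<in>set I. 0 \<le> test_time x \<and> 0 \<le> upper_bound x \<and> 0 \<le> proc_time x \<and> proc_time x \<le> upper_bound x}"

definition unit_test_instances :: "inst set" where
  "unit_test_instances = {I \<in> valid_instances. \<forall>x\<in>set I. test_time x = 1}"

text \<open>What is known initially; the number of jobs is the length of the list.\<close>

definition public_data :: "inst \<Rightarrow> (real \<times> real) list" where
  "public_data I = map (\<lambda>x. (test_time x, upper_bound x)) I"

text \<open>Jobs are the indices below \<open>length I\<close>, machines the numbers below \<open>m\<close>.
  A decision starts one job on one machine at a point in time, either untested or with a test
  that is directly followed by the execution. A schedule lists its decisions in the order in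
  which they are taken.\<close>

record decision =
  the_job :: nat
  the_machine :: nat
  the_start :: real
  tested :: bool

type_synonym schedule = "decision list"

definition duration :: "inst \<Rightarrow> decision \<Rightarrow> real" where
  "duration I d =
     (let x = I ! the_job d in
      if tested d then test_time x + proc_time x else upper_bound x)"

definition feasible :: "nat \<Rightarrow> inst \<Rightarrow> schedule \<Rightarrow> bool" where
  "feasible m I \<sigma> \<longleftrightarrow>
     distinct (map the_job \<sigma>) \<and> set (map the_job \<sigma>) = {..<length I} \<and>
     (\<forall>d\<in>set \<sigma>. the_machine d < m \<and> 0 \<le> the_start d) \<and>
     sorted (map the_start \<sigma>) \<and>
     (\<forall>k<length \<sigma>. \<forall>i<k. the_machine (\<sigma> ! i) = the_machine (\<sigma> ! k) \<longrightarrow>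
        the_start (\<sigma> ! i) + duration I (\<sigma> ! i) \<le> the_start (\<sigma> ! k))"

text \<open>The load of a machine is the total time for which it is occupied. Idle time is allowed but
  not counted; this can only favour the algorithm, and it makes no difference for the offline
  optimum.\<close>

definition machine_load :: "inst \<Rightarrow> schedule \<Rightarrow> nat \<Rightarrow> real" where
  "machine_load I \<sigma> i = (\<Sum>d\<leftarrow>filter (\<lambda>d. the_machine d = i) \<sigma>. duration I d)"

definition makespan :: "nat \<Rightarrow> inst \<Rightarrow> schedule \<Rightarrow> real" where
  "makespan m I \<sigma> = Max (machine_load I \<sigma> ` {..<m})"

definition opt :: "nat \<Rightarrow> inst \<Rightarrow> real" where
  "opt m I = Inf (makespan m I ` {\<sigma>. feasible m I \<sigma>})"

text \<open>Two instances with the same public data look alike at time \<open>\<tau>\<close> after the decisions \<open>ds\<close>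
  if every test started in \<open>ds\<close> and completed by time \<open>\<tau>\<close> reveals the same processing time
  in both.\<close>

definition same_revealed :: "inst \<Rightarrow> inst \<Rightarrow> decision list \<Rightarrow> real \<Rightarrow> bool" where
  "same_revealed I I' ds \<tau> \<longleftrightarrow>
     (\<forall>d\<in>set ds. tested d \<and> the_start d + test_time (I ! the_job d) \<le> \<tau> \<longrightarrow>
        proc_time (I ! the_job d) = proc_time (I' ! the_job d))"

text \<open>A deterministic algorithm maps every instance of the class \<open>K\<close> to a feasible schedule. It is
  online if each decision is determined by the public data, the earlier decisions and the
  processing times revealed by the time of the decision. Only tests among the earlier decisions
  count as revealed, so that a test of duration 0 is not known to the decision that starts it.\<close>

definition online_algorithm :: "nat \<Rightarrow> inst set \<Rightarrow> (inst \<Rightarrow> schedule) \<Rightarrow> bool" where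
  "online_algorithm m K A \<longleftrightarrow>
     (\<forall>I\<in>K. feasible m I (A I)) \<and>
     (\<forall>I\<in>K. \<forall>I'\<in>K. \<forall>k<length I.
        public_data I = public_data I' \<and> take k (A I) = take k (A I') \<and>
        same_revealed I I' (take k (A I)) (the_start (A I ! k))
        \<longrightarrow> A I ! k = A I' ! k)"

definition competitive :: "nat \<Rightarrow> inst set \<Rightarrow> real \<Rightarrow> (inst \<Rightarrow> schedule) \<Rightarrow> bool" where
  "competitive m K c A \<longleftrightarrow> (\<forall>I\<in>K. makespan m I (A I) \<le> c * opt m I)"

end

theory Submission
  imports Defs
begin

text \<open>The adversary presents \<open>m (m - 1) + 1\<close> jobs with testing time \<open>1\<close> and upper bound \<open>2 m\<close>,
  which all look alike. If every processing time is \<open>0\<close>, the optimum is at most \<open>m\<close>, so running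
  some job untested is too expensive. If all jobs are tested, some machine receives at least \<open>m\<close>
  of them, and the last of these jobs can be given processing time \<open>m - 1\<close> without the algorithm
  noticing before the job is placed. That machine then has load at least \<open>(m - 1) + m\<close>, while the
  optimum is still at most \<open>m\<close>: the long job gets a machine for itself and the other \<open>m (m - 1)\<close>
  jobs are spread evenly over the remaining machines.\<close>

section \<open>The adversarial instances\<close>

definition adversary :: "nat \<Rightarrow> nat \<Rightarrow> real \<Rightarrow> inst" where
  "adversary m j p = map (\<lambda>i. \<lparr>test_time = 1, upper_bound = 2 * real m,
     proc_time = (if i = j then p else 0)\<rparr>) [0..<m * (m - 1) + 1]"

lemma length_adversary [simp]: "length (adversary m j p) = m * (m - 1) + 1"
  by (simp add: adversary_def)

lemma nth_adversary:
  "i < m * (m - 1) + 1 \<Longrightarrow> adversary m j p ! i =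
     \<lparr>test_time = 1, upper_bound = 2 * real m, proc_time = (if i = j then p else 0)\<rparr>"
  unfolding adversary_def by (subst nth_map) (auto simp del: upt_Suc)

lemma public_data_adversary: "public_data (adversary m j p) = public_data (adversary m i q)"
  by (simp add: public_data_def adversary_def)

lemma adversary_unit_test:
  assumes "0 \<le> p" "p \<le> 2 * real m"
  shows "adversary m j p \<in> unit_test_instances"
  using assms by (auto simp: unit_test_instances_def valid_instances_def adversary_def)

lemma duration_adversary:
  assumes "the_job d < m * (m - 1) + 1"
  shows "duration (adversary m j p) d =
    (if tested d then 1 + (if the_job d = j then p else 0) else 2 * real m)"
  using assms by (simp add: duration_def nth_adversary Let_def)

section \<open>Loads, makespan and bounds for the optimum\<close>

text \<open>Indexing the load by positions allows a lower bound by the sum over a chosen set of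
  positions.\<close>

lemma machine_load_nth:
  "machine_load I \<sigma> i = (\<Sum>k | k < length \<sigma> \<and> the_machine (\<sigma> ! k) = i. duration I (\<sigma> ! k))"
proof -
  have "machine_load I \<sigma> i =
      (\<Sum>k<length \<sigma>. if the_machine (\<sigma> ! k) = i then duration I (\<sigma> ! k) else 0)"
    unfolding machine_load_def sum_list_map_filter'
    by (simp add: sum_list_sum_nth atLeast0LessThan)
  also have "\<dots> = (\<Sum>k | k < length \<sigma> \<and> the_machine (\<sigma> ! k) = i. duration I (\<sigma> ! k))"
    by (simp add: sum.If_cases Int_def conj_commute)
  finally show ?thesis .
qed

lemma feasible_job_less: "feasible m I \<sigma> \<Longrightarrow> d \<in> set \<sigma> \<Longrightarrow> the_job d < length I"
  by (auto simp: feasible_def)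

lemma feasible_length: "feasible m I \<sigma> \<Longrightarrow> length \<sigma> = length I"
  unfolding feasible_def by (metis card_lessThan distinct_card length_map)

lemma duration_nonneg:
  assumes "I \<in> valid_instances" "the_job d < length I"
  shows "0 \<le> duration I d"
  using assms nth_mem[OF assms(2)] by (auto simp: duration_def valid_instances_def Let_def)

lemma machine_load_le_makespan: "i < m \<Longrightarrow> machine_load I \<sigma> i \<le> makespan m I \<sigma>"
  by (simp add: makespan_def)

lemma duration_le_makespan:
  assumes "I \<in> valid_instances" "feasible m I \<sigma>" "d \<in> set \<sigma>"
  shows "duration I d \<le> makespan m I \<sigma>"
proof -
  have "duration I d \<le> machine_load I \<sigma> (the_machine d)"
    unfolding machine_load_def
    using assms by (intro member_le_sum_list)
      (auto intro!: duration_nonneg dest: feasible_job_less)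
  also have "\<dots> \<le> makespan m I \<sigma>"
    using assms by (intro machine_load_le_makespan) (auto simp: feasible_def)
  finally show ?thesis .
qed

lemma makespan_nonneg:
  assumes "m \<ge> 1" "I \<in> valid_instances" "feasible m I \<sigma>"
  shows "0 \<le> makespan m I \<sigma>"
proof -
  have "0 \<le> machine_load I \<sigma> 0"
    unfolding machine_load_def
    using assms by (intro sum_list_nonneg) (auto intro!: duration_nonneg dest: feasible_job_less)
  also have "\<dots> \<le> makespan m I \<sigma>"
    using assms by (intro machine_load_le_makespan) auto
  finally show ?thesis .
qed

text \<open>\<open>opt\<close> is an infimum of reals, so a lower bound for all makespans is
  required; nonnegativity supplies \<open>0\<close>.\<close>

lemma opt_le_makespan:
  assumes "m \<ge> 1" "I \<in> valid_instances" "feasible m I \<sigma>"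
  shows "opt m I \<le> makespan m I \<sigma>"
  unfolding opt_def using assms
  by (intro cInf_lower bdd_belowI[where m = 0]) (auto intro: makespan_nonneg)

text \<open>The given schedule \<open>\<sigma>\<close> witnesses that the infimum is taken over a
  nonempty set.\<close>

lemma opt_nonneg:
  assumes "m \<ge> 1" "I \<in> valid_instances" "feasible m I \<sigma>"
  shows "0 \<le> opt m I"
  unfolding opt_def using assms
  by (intro cInf_greatest) (auto intro: makespan_nonneg)

section \<open>An offline schedule of makespan at most \<open>m\<close>\<close>

definition long_decision :: "nat \<Rightarrow> decision" where
  "long_decision j = \<lparr>the_job = j, the_machine = 0, the_start = 0, tested = True\<rparr>"

text \<open>Round robin: \<open>r\<close> enumerates the jobs other than \<open>j\<close>, skipping
  \<open>j\<close>. Machine 0 is reserved for \<open>j\<close>, hence the \<open>Suc\<close>;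
  \<open>w\<close> is the number of remaining machines, and \<open>r div w\<close> is the round,
  each round taking one unit of time. Start times are thus nondecreasing in
  \<open>r\<close>.\<close>

definition short_decision :: "nat \<Rightarrow> nat \<Rightarrow> nat \<Rightarrow> decision" where
  "short_decision w j r = \<lparr>the_job = (if r < j then r else Suc r), the_machine = Suc (r mod w),
     the_start = real (r div w), tested = True\<rparr>"

definition offline_schedule :: "nat \<Rightarrow> nat \<Rightarrow> schedule" where
  "offline_schedule m j =
     long_decision j # map (short_decision (m - 1) j) [0..<m * (m - 1)]"

lemma short_jobs:
  assumes "j \<le> n"
  shows "(\<lambda>r. if r < j then r else Suc r) ` {0..<n} = {..<Suc n} - {j}" (is "?f ` _ = _")
proof
  show "?f ` {0..<n} \<subseteq> {..<Suc n} - {j}" using assms by auto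
  show "{..<Suc n} - {j} \<subseteq> ?f ` {0..<n}"
  proof
    fix i assume i: "i \<in> {..<Suc n} - {j}"
    show "i \<in> ?f ` {0..<n}"
    proof (cases "i < j")
      case True
      then show ?thesis using assms by (intro image_eqI[of _ _ i]) auto
    next
      case False
      then show ?thesis using i by (intro image_eqI[of _ _ "i - 1"]) auto
    qed
  qed
qed

lemma feasible_offline_schedule:
  assumes m: "m \<ge> 1" and j: "j < m * (m - 1) + 1"
  shows "feasible m (adversary m j p) (offline_schedule m j)"
  unfolding feasible_def
proof (intro conjI)
  let ?n = "m * (m - 1)" and ?f = "\<lambda>r. if r < j then r else Suc r"
  have jobs: "map the_job (offline_schedule m j) = j # map ?f [0..<?n]"
    by (simp add: offline_schedule_def long_decision_def short_decision_def)
  have img: "?f ` {0..<?n} = {..<Suc ?n} - {j}"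
    using j by (intro short_jobs) simp
  have "inj_on ?f {0..<?n}"
    by (auto simp: inj_on_def split: if_splits)
  moreover have "j \<notin> ?f ` {0..<?n}"
    using img by blast
  ultimately show "distinct (map the_job (offline_schedule m j))"
    unfolding jobs by (simp add: distinct_map)
  have "set (map the_job (offline_schedule m j)) = insert j (?f ` {0..<?n})"
    unfolding jobs by simp
  also have "\<dots> = {..<length (adversary m j p)}"
    unfolding img using j by auto
  finally show "set (map the_job (offline_schedule m j)) = {..<length (adversary m j p)}" .
  \<comment> \<open>The existence of such an \<open>r\<close> excludes \<open>m = 1\<close>, where
    the modulus would be 0.\<close>
  have "Suc (r mod (m - 1)) < m" if "r < ?n" for r
  proof -
    have "m - 1 > 0" using that by (cases "m - 1") auto
    then have "r mod (m - 1) < m - 1" by simp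
    then show ?thesis by simp
  qed
  then show "\<forall>d\<in>set (offline_schedule m j). the_machine d < m \<and> 0 \<le> the_start d"
    using m by (auto simp: offline_schedule_def long_decision_def short_decision_def)
  show "sorted (map the_start (offline_schedule m j))"
    by (auto simp: offline_schedule_def long_decision_def short_decision_def
        sorted_iff_nth_mono div_le_mono)
  show "\<forall>k<length (offline_schedule m j). \<forall>i<k.
          the_machine (offline_schedule m j ! i) = the_machine (offline_schedule m j ! k) \<longrightarrow>
          the_start (offline_schedule m j ! i) +
            duration (adversary m j p) (offline_schedule m j ! i)
          \<le> the_start (offline_schedule m j ! k)"
  proof (intro allI impI)
    fix k i
    assume k: "k < length (offline_schedule m j)" and ik: "i < k"
      and same: "the_machine (offline_schedule m j ! i) = the_machine (offline_schedule m j ! k)"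
    from ik obtain k' where k': "k = Suc k'" by (cases k) auto
    have k'n: "k' < ?n" using k k' by (simp add: offline_schedule_def)
    have dk: "offline_schedule m j ! k = short_decision (m - 1) j k'"
      using k'n k' by (simp add: offline_schedule_def)
    \<comment> \<open>Position 0 is impossible for \<open>i\<close>: it holds the long job on
      machine 0, while the decision at \<open>k\<close> uses a machine of positive index.\<close>
    obtain i' where i': "i = Suc i'"
      using same dk by (cases i)
        (auto simp: offline_schedule_def long_decision_def short_decision_def)
    have i'k': "i' < k'" using ik i' k' by simp
    have di: "offline_schedule m j ! i = short_decision (m - 1) j i'"
      using k'n i'k' i' by (simp add: offline_schedule_def)
    \<comment> \<open>Equal remainders put the two jobs into different rounds, so their starts
      differ by at least 1, the duration of a tested short job.\<close>
    have "i' mod (m - 1) = k' mod (m - 1)"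
      using same by (simp add: di dk short_decision_def)
    then have "i' div (m - 1) \<noteq> k' div (m - 1)"
      using i'k' by (metis div_mult_mod_eq less_irrefl)
    moreover have "i' div (m - 1) \<le> k' div (m - 1)"
      using i'k' by (intro div_le_mono) simp
    ultimately have "i' div (m - 1) + 1 \<le> k' div (m - 1)"
      by simp
    then have "real (i' div (m - 1)) + 1 \<le> real (k' div (m - 1))"
      by linarith
    moreover have "duration (adversary m j p) (short_decision (m - 1) j i') = 1"
      using k'n i'k' by (subst duration_adversary) (auto simp: short_decision_def)
    ultimately show "the_start (offline_schedule m j ! i) +
        duration (adversary m j p) (offline_schedule m j ! i)
        \<le> the_start (offline_schedule m j ! k)"
      unfolding di dk by (simp add: short_decision_def)
  qed
qed

text \<open>Once the remainder is fixed, the quotient determines \<open>r\<close>, and only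
  quotients below \<open>a\<close> occur.\<close>

lemma card_mod_eq_le: "card {r. r < a * w \<and> r mod w = q} \<le> (a :: nat)"
proof -
  have "inj_on (\<lambda>r. r div w) {r. r < a * w \<and> r mod w = q}"
    by (rule inj_onI) (metis (mono_tags, lifting) div_mult_mod_eq mem_Collect_eq)
  moreover have "(\<lambda>r. r div w) ` {r. r < a * w \<and> r mod w = q} \<subseteq> {..<a}"
    by (auto simp: less_mult_imp_div_less)
  ultimately have "card {r. r < a * w \<and> r mod w = q} \<le> card {..<a}"
    by (intro card_inj_on_le) auto
  then show ?thesis by simp
qed

text \<open>Machine 0 carries only \<open>1 + p\<close>, which the bound on \<open>p\<close> keeps
  within \<open>m\<close>; every other machine carries at most \<open>m\<close> unit jobs, at most
  one per round.\<close>

lemma makespan_offline_schedule: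
  assumes m: "m \<ge> 1" and j: "j < m * (m - 1) + 1" and p: "p \<le> real m - 1"
  shows "makespan m (adversary m j p) (offline_schedule m j) \<le> real m"
proof -
  let ?n = "m * (m - 1)" and ?I = "adversary m j p"
  have short: "duration ?I (short_decision (m - 1) j r) = 1" if "r < ?n" for r
    using that by (subst duration_adversary) (auto simp: short_decision_def)
  have long: "duration ?I (long_decision j) \<le> real m"
    using j p by (subst duration_adversary) (auto simp: long_decision_def)
  have "machine_load ?I (offline_schedule m j) i \<le> real m" for i
  proof (cases i)
    case 0
    then have "filter (\<lambda>d. the_machine d = i) (offline_schedule m j) = [long_decision j]"
      by (auto simp: offline_schedule_def long_decision_def short_decision_def filter_empty_conv)
    then show ?thesis using long by (simp add: machine_load_def)
  next
    case (Suc q)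
    have "machine_load ?I (offline_schedule m j) i =
        (\<Sum>r\<leftarrow>[0..<?n]. if r mod (m - 1) = q then duration ?I (short_decision (m - 1) j r) else 0)"
      using Suc
      by (simp add: machine_load_def offline_schedule_def sum_list_map_filter' o_def
          long_decision_def short_decision_def del: One_nat_def)
    also have "\<dots> = (\<Sum>r\<in>{0..<?n}. if r mod (m - 1) = q
        then duration ?I (short_decision (m - 1) j r) else 0)"
      by (simp add: interv_sum_list_conv_sum_set_nat)
    also have "\<dots> = (\<Sum>r\<in>{0..<?n}. if r mod (m - 1) = q then 1 else 0)"
      by (intro sum.cong) (use short in auto)
    also have "\<dots> = real (card {r. r < ?n \<and> r mod (m - 1) = q})"
      by (simp add: sum.If_cases Int_def)
    also have "\<dots> \<le> real m"
      using card_mod_eq_le by simp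
    finally show ?thesis .
  qed
  then show ?thesis
    unfolding makespan_def using m by (subst Max_le_iff) (auto simp: lessThan_empty_iff)
qed

text \<open>The upper bound limits what a competitive algorithm may spend; the lower bound serves
  the case of a negative ratio.\<close>

lemma opt_adversary:
  assumes "m \<ge> 1" "j < m * (m - 1) + 1" "0 \<le> p" "p \<le> real m - 1"
  shows "0 \<le> opt m (adversary m j p)" "opt m (adversary m j p) \<le> real m"
proof -
  have "adversary m j p \<in> valid_instances"
    using adversary_unit_test[of p m j] assms by (simp add: unit_test_instances_def)
  note * = assms(1) this feasible_offline_schedule[OF assms(1,2)]
  show "0 \<le> opt m (adversary m j p)" by (rule opt_nonneg[OF *])
  show "opt m (adversary m j p) \<le> real m"
    using opt_le_makespan[OF *] makespan_offline_schedule[OF assms(1,2,4)] by linarith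
qed

section \<open>Pigeonhole, indistinguishability and the lower bound\<close>

text \<open>Pigeonhole: with at most \<open>m - 1\<close> decisions on each machine, only
  \<open>m * (m - 1)\<close> could be placed.\<close>

lemma busy_machine:
  assumes m: "m \<ge> 1" and len: "length \<sigma> = m * (m - 1) + 1"
    and mach: "\<forall>d\<in>set \<sigma>. the_machine d < m"
  shows "\<exists>i<m. card {k. k < length \<sigma> \<and> the_machine (\<sigma> ! k) = i} \<ge> m"
proof (rule ccontr)
  let ?S = "\<lambda>i. {k. k < length \<sigma> \<and> the_machine (\<sigma> ! k) = i}"
  assume "\<not> (\<exists>i<m. card (?S i) \<ge> m)"
  then have few: "card (?S i) \<le> m - 1" if "i < m" for i
    using that by fastforce
  have "{..<length \<sigma>} = (\<Union>i<m. ?S i)"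
    using mach by auto
  then have "length \<sigma> = card (\<Union>i<m. ?S i)"
    by (metis card_lessThan)
  also have "\<dots> \<le> (\<Sum>i<m. card (?S i))"
    by (intro card_UN_le) simp
  also have "\<dots> \<le> (\<Sum>i<m. m - 1)"
    by (intro sum_mono few) simp
  finally show False using len by simp
qed

text \<open>Agreement is demanded for all jobs started before \<open>k\<close>, whether or not their
  tests have completed, so decision times do not matter. The job of decision \<open>k\<close> itself
  is exempt, since its test reveals nothing before that decision is taken; hence the prefix of
  length \<open>Suc k\<close>.\<close>

lemma online_prefix_eq:
  assumes online: "online_algorithm m K A"
    and K: "I \<in> K" "I' \<in> K"
    and pub: "public_data I = public_data I'"
    and k: "k < length I"
    and same: "\<And>i. i < k \<Longrightarrow>
      proc_time (I ! the_job (A I ! i)) = proc_time (I' ! the_job (A I ! i))"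
  shows "take (Suc k) (A I) = take (Suc k) (A I')"
proof -
  have "length I = length I'"
    using pub unfolding public_data_def by (metis length_map)
  then have len: "length (A I) = length I" "length (A I') = length I"
    using online K feasible_length unfolding online_algorithm_def by metis+
  have "take l (A I) = take l (A I')" if "l \<le> Suc k" for l
    using that
  proof (induction l)
    case (Suc l)
    then have eq: "take l (A I) = take l (A I')" and l: "l < length I" "l \<le> k"
      using k by auto
    have "same_revealed I I' (take l (A I)) (the_start (A I ! l))"
      using same l len by (auto simp: same_revealed_def in_set_conv_nth)
    then have "A I ! l = A I' ! l"
      using online K pub eq l unfolding online_algorithm_def by blast
    then show ?case
      using eq l len by (simp add: take_Suc_conv_app_nth)
  qed simp
  then show ?thesis by simp
qed

text \<open>Leaving \<open>K\<close> open lets one argument serve both the general class and the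
  class of unit testing times.\<close>

lemma adversary_beats_online:
  assumes m: "m \<ge> 1" and unit: "unit_test_instances \<subseteq> K" and online: "online_algorithm m K A"
  obtains j p where "j < m * (m - 1) + 1" "0 \<le> p" "p \<le> real m - 1"
    "makespan m (adversary m j p) (A (adversary m j p)) \<ge> 2 * real m - 1"
proof -
  let ?n = "m * (m - 1) + 1" and ?I = "adversary m 0 0"
  have adv: "adversary m j p \<in> K" "adversary m j p \<in> valid_instances"
    if "0 \<le> p" "p \<le> real m - 1" for j p
    using adversary_unit_test[of p m j] that unit by (auto simp: unit_test_instances_def)
  have feas: "feasible m I (A I)" if "I \<in> K" for I
    using online that by (simp add: online_algorithm_def)
  have I: "?I \<in> K" "?I \<in> valid_instances"
    using adv[of 0 0] m by auto
  have len: "length (A ?I) = ?n"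
    using feasible_length[OF feas[OF I(1)]] by simp
  show thesis
  proof (cases "\<forall>d\<in>set (A ?I). tested d")
    case False
    then obtain d where d: "d \<in> set (A ?I)" "\<not> tested d" by blast
    have "the_job d < ?n"
      using feasible_job_less[OF feas[OF I(1)] d(1)] by simp
    then have "duration ?I d = 2 * real m"
      using d(2) by (simp add: duration_adversary)
    then have "2 * real m \<le> makespan m ?I (A ?I)"
      using duration_le_makespan[OF I(2) feas[OF I(1)] d(1)] by simp
    then show thesis
      using m by (intro that[of 0 0]) auto
  next
    case True
    have "\<forall>d\<in>set (A ?I). the_machine d < m"
      using feas[OF I(1)] by (simp add: feasible_def)
    from busy_machine[OF m len this] obtain i where
      i: "i < m" and card: "card {k. k < length (A ?I) \<and> the_machine (A ?I ! k) = i} \<ge> m"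
      by blast
    define S where "S = {k. k < length (A ?I) \<and> the_machine (A ?I ! k) = i}"
    have S: "finite S" "card S \<ge> m"
      using card by (auto simp: S_def)
    then have "S \<noteq> {}"
      using m by auto
    \<comment> \<open>The last position on the busy machine \<open>i\<close>: its job is the one to
      lengthen, and all other jobs of \<open>S\<close> are placed before it.\<close>
    define k where "k = Max S"
    have kS: "k \<in> S" and kmax: "\<And>l. l \<in> S \<Longrightarrow> l \<le> k"
      using S \<open>S \<noteq> {}\<close> by (auto simp: k_def)
    define j where "j = the_job (A ?I ! k)"
    define J where "J = adversary m j (real m - 1)"
    have k: "k < length (A ?I)" using kS by (simp add: S_def)
    have j: "j < ?n"
      using feasible_job_less[OF feas[OF I(1)] nth_mem[OF k]] by (simp add: j_def)
    have J: "J \<in> K" "J \<in> valid_instances"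
      using adv[of "real m - 1" j] m by (auto simp: J_def)
    have lenJ: "length (A J) = ?n"
      using feasible_length[OF feas[OF J(1)]] by (simp add: J_def)
    \<comment> \<open>The instances \<open>?I\<close> and \<open>J\<close> differ only in job
      \<open>j\<close>, which is not started before \<open>k\<close>, so the algorithm cannot
      distinguish them until then.\<close>
    have dist: "the_job (A ?I ! l) \<noteq> j" if "l < k" for l
    proof -
      have "distinct (map the_job (A ?I))"
        using feas[OF I(1)] by (simp add: feasible_def)
      from nth_eq_iff_index_eq[OF this, of l k] show ?thesis
        using that k by (simp add: j_def)
    qed
    have job: "the_job (A ?I ! l) < ?n" if "l \<le> k" for l
      using feasible_job_less[OF feas[OF I(1)] nth_mem, of l] that k by simp
    have "take (Suc k) (A ?I) = take (Suc k) (A J)"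
    proof (rule online_prefix_eq[OF online I(1) J(1)])
      show "public_data ?I = public_data J"
        unfolding J_def by (rule public_data_adversary)
      show "k < length ?I" using k len by simp
      show "proc_time (?I ! the_job (A ?I ! l)) = proc_time (J ! the_job (A ?I ! l))"
        if "l < k" for l
        using dist[OF that] job[of l] that by (simp add: J_def nth_adversary)
    qed
    then have same: "A J ! l = A ?I ! l" if "l \<le> k" for l
      using that by (metis le_imp_less_Suc nth_take)
    have dur: "duration J (A J ! l) = (if l = k then real m else 1)" if "l \<in> S" for l
    proof -
      have l: "l \<le> k" using kmax that .
      then have "tested (A ?I ! l)" using True k by simp
      then show ?thesis
        unfolding same[OF l] using dist[of l] l job[OF l]
        by (auto simp: J_def duration_adversary j_def)
    qed
    \<comment> \<open>The long job takes \<open>1 + (m - 1) = m\<close>, and the at least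
      \<open>m - 1\<close> other jobs of \<open>S\<close> take 1 each.\<close>
    have "2 * real m - 1 \<le> real m + real (card (S - {k}))"
      using S kS m by (simp add: of_nat_diff)
    also have "\<dots> = (\<Sum>l\<in>S. duration J (A J ! l))"
      using S kS dur by (simp add: sum.remove[of S k])
    \<comment> \<open>After \<open>k\<close> the two schedules may diverge, but further jobs on
      machine \<open>i\<close> can only add to its load.\<close>
    also have "\<dots> \<le> machine_load J (A J) i"
      unfolding machine_load_nth
    proof (rule sum_mono2)
      show "S \<subseteq> {l. l < length (A J) \<and> the_machine (A J ! l) = i}"
        using kmax same len lenJ by (auto simp: S_def)
      show "0 \<le> duration J (A J ! l)"
        if "l \<in> {l. l < length (A J) \<and> the_machine (A J ! l) = i} - S" for l
        using that feas[OF J(1)] by (intro duration_nonneg[OF J(2)] feasible_job_less) auto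
    qed simp
    also have "\<dots> \<le> makespan m J (A J)"
      using i by (rule machine_load_le_makespan)
    finally show thesis
      using m j by (intro that[of j "real m - 1"]) (auto simp: J_def)
  qed
qed

lemma not_competitive:
  assumes m: "m \<ge> 1" and c: "c < 2 - 1 / real m"
    and unit: "unit_test_instances \<subseteq> K" and online: "online_algorithm m K A"
  shows "\<not> competitive m K c A"
proof
  assume comp: "competitive m K c A"
  from adversary_beats_online[OF m unit online] obtain j p where
    j: "j < m * (m - 1) + 1" and p: "0 \<le> p" "p \<le> real m - 1" and
    alg: "makespan m (adversary m j p) (A (adversary m j p)) \<ge> 2 * real m - 1" .
  have "adversary m j p \<in> K"
    using adversary_unit_test[of p m j] p unit by auto
  then have le: "2 * real m - 1 \<le> c * opt m (adversary m j p)"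
    using comp alg unfolding competitive_def by fastforce
  note opt = opt_adversary[OF m j p]
  show False
  \<comment> \<open>Scaling \<open>opt\<close> at most \<open>m\<close> by \<open>c\<close> needs
    \<open>c\<close> nonnegative; for negative \<open>c\<close> the bound is at most 0, below
    \<open>2 * m - 1\<close>.\<close>
  proof (cases "c \<ge> 0")
    case True
    have "c * opt m (adversary m j p) \<le> c * real m"
      using True opt by (intro mult_left_mono)
    also have "\<dots> < (2 - 1 / real m) * real m"
      using c m by (intro mult_strict_right_mono) auto
    also have "\<dots> = 2 * real m - 1"
      using m by (simp add: field_simps)
    finally show False using le by simp
  next
    case False
    then have "c * opt m (adversary m j p) \<le> 0"
      using opt by (simp add: mult_nonpos_nonneg)
    then show False using le m by simp
  qed
qed

theorem theorem1:
  fixes m :: nat and c :: real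
  assumes "m \<ge> 1" and "c < 2 - 1 / real m"
  shows "(\<nexists>A. online_algorithm m valid_instances A \<and> competitive m valid_instances c A) \<and>
         (\<nexists>A. online_algorithm m unit_test_instances A \<and> competitive m unit_test_instances c A)"
proof -
  have "unit_test_instances \<subseteq> valid_instances"
    by (auto simp: unit_test_instances_def)
  then show ?thesis
    using not_competitive[OF assms] by blast
qed

end
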